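(* Let $n\ge 2$, $N\ge 2$ be integers, let $k_1,\ldots,k_n\in\{1,\ldots,N\}$, let $\gamma_1,\ldots,\gamma_n$ be positive constants, and let $B=\{x\in\mathbb{R}^N:|x|<1\}$. Suppose that $$\prod_{i=1}^{n}\gamma_i=\prod_{i=1}^{n}k_i.$$ Then the system $$S_{k_i}(D^2u_i)=(-u_{i+1})^{\gamma_i}\ \text{in } B\ (i=1,\ldots,n-1),\qquad S_{k_n}(D^2u_n)=(-u_1)^{\gamma_n}\ \text{in } B,\qquad u_i=0\ \text{on }\partial B\ (i=1,\ldots,n)$$ admits no nontrivial radial $\boldsymbol{k}$-admissible solution, where $\boldsymbol{k}=(k_1,\ldots,k_n)$.
   Context: For $k\in\{1,\ldots,N\}$ the $k$-Hessian operator is $S_k(D^2u)=S_k(\lambda(D^2u))=\sum_{1\le i_1<\cdots<i_k\le N}\lambda_{i_1}\cdots\lambda_{i_k}$, where $\lambda(D^2u)=(\lambda_1,\ldots,\lambda_N)$ is the vector of eigenvalues of the Hessian matrix $D^2u$. Let $\sigma_k=\{\lambda\in\mathbb{R}^N: S_l(\lambda)>0,\ l=1,\ldots,k\}$. A function $u\in C^2(\Omega)\cap C^0(\overline{\Omega})$ is $k$-admissible if $\lambda(D^2u)\in\overline{\sigma}_k$ in $\Omega$. A solution $(u_1,\ldots,u_n)$ of the system is $\boldsymbol{k}$-admissible if $u_i$ is $k_i$-admissible for every $i=1,\ldots,n$; it is radial if every $u_i(x)$ depends only on $|x|$, and nontrivial if it is not identically $(0,\ldots,0)$. Solutions are classical.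 *)

theory Defs
  imports "HOL-Analysis.Analysis"
begin

definition partial :: "'n \<Rightarrow> (real ^ 'n \<Rightarrow> real) \<Rightarrow> real ^ 'n \<Rightarrow> real"
  where "partial i u x = frechet_derivative u (at x) (axis i 1)"

definition hessian :: "(real ^ 'n \<Rightarrow> real) \<Rightarrow> real ^ 'n \<Rightarrow> real ^ 'n ^ 'n"
  where "hessian u x = (\<chi> i j. partial i (partial j u) x)"

(* Meant for open D. Differentiability makes frechet_derivative the actual derivative;
   continuity of u and of its first partial derivatives follows from differentiability. *)
definition C2_on :: "(real ^ 'n \<Rightarrow> real) \<Rightarrow> (real ^ 'n) set \<Rightarrow> bool"
  where "C2_on u D \<longleftrightarrow>
    (\<forall>x\<in>D. u differentiable (at x)) \<and>
    (\<forall>i. \<forall>x\<in>D. partial i u differentiable (at x)) \<and>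
    (\<forall>i j. continuous_on D (partial i (partial j u)))"

(* The entries of l are the roots of the characteristic polynomial of A, with multiplicity. *)
definition is_eigenvalue_vector :: "real ^ 'n ^ 'n \<Rightarrow> real ^ 'n \<Rightarrow> bool"
  where "is_eigenvalue_vector A l \<longleftrightarrow> (\<forall>t. det (mat t - A) = (\<Prod>i\<in>UNIV. t - l $ i))"

(* Such a vector exists for symmetric A and is unique up to permutation of its entries;
   it is only used through elem_sym and sigma_cone, which are permutation invariant. *)
definition eigenvalues :: "real ^ 'n ^ 'n \<Rightarrow> real ^ 'n"
  where "eigenvalues A = (SOME l. is_eigenvalue_vector A l)"

definition elem_sym :: "nat \<Rightarrow> real ^ 'n \<Rightarrow> real"
  where "elem_sym k l = (\<Sum>I | card I = k. \<Prod>i\<in>I. l $ i)"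

definition hessian_op :: "nat \<Rightarrow> (real ^ 'n \<Rightarrow> real) \<Rightarrow> real ^ 'n \<Rightarrow> real"
  where "hessian_op k u x = elem_sym k (eigenvalues (hessian u x))"

definition sigma_cone :: "nat \<Rightarrow> (real ^ 'n) set"
  where "sigma_cone k = {l. \<forall>j\<in>{1..k}. elem_sym j l > 0}"

definition admissible :: "nat \<Rightarrow> (real ^ 'n) set \<Rightarrow> (real ^ 'n \<Rightarrow> real) \<Rightarrow> bool"
  where "admissible k D u \<longleftrightarrow>
    C2_on u D \<and> continuous_on (closure D) u \<and>
    (\<forall>x\<in>D. eigenvalues (hessian u x) \<in> closure (sigma_cone k))"

(* The unknowns are u 1, ..., u n, viewed as functions on the closed unit ball: their values
   elsewhere are irrelevant. The base of powr is nonnegative for solutions, since an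
   admissible u i is subharmonic and vanishes on the boundary. *)
definition hessian_system ::
  "nat \<Rightarrow> (nat \<Rightarrow> nat) \<Rightarrow> (nat \<Rightarrow> real) \<Rightarrow> (nat \<Rightarrow> real ^ 'n \<Rightarrow> real) \<Rightarrow> bool"
  where "hessian_system n k \<gamma> u \<longleftrightarrow>
    (\<forall>i\<in>{1..n - 1}. \<forall>x\<in>ball 0 1. hessian_op (k i) (u i) x = (- u (i + 1) x) powr \<gamma> i) \<and>
    (\<forall>x\<in>ball 0 1. hessian_op (k n) (u n) x = (- u 1 x) powr \<gamma> n) \<and>
    (\<forall>i\<in>{1..n}. \<forall>x\<in>sphere 0 1. u i x = 0)"

definition admissible_solution ::
  "nat \<Rightarrow> (nat \<Rightarrow> nat) \<Rightarrow> (nat \<Rightarrow> real) \<Rightarrow> (nat \<Rightarrow> real ^ 'n \<Rightarrow> real) \<Rightarrow> bool"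
  where "admissible_solution n k \<gamma> u \<longleftrightarrow>
    (\<forall>i\<in>{1..n}. admissible (k i) (ball 0 1) (u i)) \<and> hessian_system n k \<gamma> u"

definition radial :: "nat \<Rightarrow> (nat \<Rightarrow> real ^ 'n \<Rightarrow> real) \<Rightarrow> bool"
  where "radial n u \<longleftrightarrow>
    (\<forall>i\<in>{1..n}. \<forall>x\<in>cball 0 1. \<forall>y\<in>cball 0 1. norm x = norm y \<longrightarrow> u i x = u i y)"

definition nontrivial :: "nat \<Rightarrow> (nat \<Rightarrow> real ^ 'n \<Rightarrow> real) \<Rightarrow> bool"
  where "nontrivial n u \<longleftrightarrow> (\<exists>i\<in>{1..n}. \<exists>x\<in>cball 0 1. u i x \<noteq> 0)"

end

theory Submission
  imports Defs
begin

text \<open>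
  Radial symmetry plays no role. By the maximum principle an admissible u vanishing on the unit
  sphere is nonpositive, and if S_k(D^2 u) < a^k in the ball, then u lies above the paraboloid
  (a/2)(|x|^2 - 1): at an interior minimum of the difference all eigenvalues of D^2 u are at
  least a, so S_k(D^2 u) is at least a^k. Hence the maxima m_i of -u_i satisfy
  m_i <= (1/2) m_{i+1}^{theta_i} cyclically, with theta_i = gamma_i / k_i of product 1. If they
  were positive, the inequalities for ln m_i, weighted by theta_1 ... theta_{i-1}, would
  telescope to 0 < 0.
\<close>

section \<open>Spectral theory of symmetric matrices\<close>

lemma linear_coeff_zero_of_nonneg:
  fixes b c :: real
  assumes "\<And>t. 0 \<le> b * t + c * t\<^sup>2"
  shows "b = 0"
proof (rule ccontr)
  assume "b \<noteq> 0"
  define K where "K = \<bar>c\<bar> + 1"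
  have K: "K > 0" "c < K" by (auto simp: K_def)
  \<comment> \<open>The test point is \<open>t = - b / K\<close>. Taking K above c makes the
    negative linear term outweigh the quadratic one.\<close>
  have "0 \<le> b * (- b / K) + c * (- b / K)\<^sup>2" by (rule assms)
  also have "\<dots> = (b\<^sup>2 / K\<^sup>2) * (c - K)"
    using K by (simp add: field_simps power2_eq_square)
  also have "\<dots> < 0"
    using K \<open>b \<noteq> 0\<close> by (intro mult_pos_neg) auto
  finally show False by simp
qed

text \<open>A maximizer v of the quadratic form of f on the compact unit sphere of S is an
  eigenvector. With c the maximum value, the form of c - f is nonnegative on S and vanishes at v, so
  its first variation at v vanishes too.\<close>

lemma selfadjoint_eigenvector:
  fixes f :: "'a::euclidean_space \<Rightarrow> 'a"
  assumes f: "linear f" and sym: "\<And>x y. f x \<bullet> y = x \<bullet> f y"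
    and S: "subspace S" and inv: "f ` S \<subseteq> S" and "S \<noteq> {0}"
  obtains v c where "v \<in> S" "norm v = 1" "f v = c *\<^sub>R v"
proof -
  interpret f: linear f by fact
  obtain w where w: "w \<in> S" "w \<noteq> 0"
    using \<open>S \<noteq> {0}\<close> subspace_0[OF S] by blast
  have "(1 / norm w) *\<^sub>R w \<in> sphere 0 1 \<inter> S"
    using w S by (auto simp: subspace_scale)
  moreover have "compact (sphere 0 1 \<inter> S)"
    using closed_subspace[OF S] by (intro compact_Int_closed) auto
  moreover have "continuous_on (sphere 0 1 \<inter> S) (\<lambda>x. f x \<bullet> x)"
    using linear_continuous_on[of f] f
    by (intro continuous_intros) (auto simp: linear_conv_bounded_linear)
  ultimately obtain v where v: "v \<in> S" "norm v = 1"
    and max: "\<And>y. y \<in> S \<Longrightarrow> norm y = 1 \<Longrightarrow> f y \<bullet> y \<le> f v \<bullet> v"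
    using continuous_attains_sup[of "sphere 0 1 \<inter> S" "\<lambda>x. f x \<bullet> x"]
    by (metis (no_types, lifting) Int_iff empty_iff mem_sphere_0)
  define c where "c = f v \<bullet> v"
  have vv: "v \<bullet> v = 1" using v by (simp add: norm_eq_1)
  have le: "f x \<bullet> x \<le> c * (x \<bullet> x)" if "x \<in> S" for x
  proof (cases "x = 0")
    case False
    then have "f ((1 / norm x) *\<^sub>R x) \<bullet> ((1 / norm x) *\<^sub>R x) \<le> c"
      unfolding c_def using that S by (intro max) (auto simp: subspace_scale)
    then show ?thesis
      using False by (simp add: f.scale field_simps dot_square_norm power2_eq_square)
  qed (simp add: f.zero)
  define d where "d = c *\<^sub>R v - f v"
  have "d \<in> S"
    using v inv S by (auto simp: d_def intro!: subspace_diff subspace_scale)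
  \<comment> \<open>The perturbation goes along the residual d itself, so that the coefficient of t
    is twice the squared norm of d. Its vanishing says that v is an eigenvector.\<close>
  have "0 \<le> (2 * (d \<bullet> d)) * t + (c * (d \<bullet> d) - f d \<bullet> d) * t\<^sup>2" for t
  proof -
    have "v + t *\<^sub>R d \<in> S"
      using v \<open>d \<in> S\<close> S by (auto intro!: subspace_add subspace_scale)
    then have "0 \<le> c * ((v + t *\<^sub>R d) \<bullet> (v + t *\<^sub>R d)) - f (v + t *\<^sub>R d) \<bullet> (v + t *\<^sub>R d)"
      using le by fastforce
    also have "\<dots> = (2 * (c * (v \<bullet> d) - f v \<bullet> d)) * t + (c * (d \<bullet> d) - f d \<bullet> d) * t\<^sup>2"
      using sym[of d v]
      by (simp add: f.add f.scale inner_simps vv power2_eq_square algebra_simps inner_commute c_def)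
    also have "c * (v \<bullet> d) - f v \<bullet> d = d \<bullet> d"
      by (simp add: d_def inner_diff_left)
    finally show ?thesis .
  qed
  then have "2 * (d \<bullet> d) = 0" by (rule linear_coeff_zero_of_nonneg)
  then have "f v = c *\<^sub>R v" by (simp add: d_def)
  with v show ?thesis by (rule that)
qed

text \<open>Split off one unit eigenvector v and induct on the dimension. The orthogonal complement
  of v in S is again invariant, because self-adjointness moves f onto v, which it only rescales.
  Arbitrary invariant subspaces S are allowed to make this induction possible.\<close>

lemma selfadjoint_orthonormal_eigenbasis:
  fixes f :: "'a::euclidean_space \<Rightarrow> 'a"
  assumes f: "linear f" and sym: "\<And>x y. f x \<bullet> y = x \<bullet> f y"
    and "subspace S" and "f ` S \<subseteq> S"
  shows "\<exists>B. pairwise orthogonal B \<and> (\<forall>b\<in>B. norm b = 1) \<and> span B = S \<and>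
    (\<forall>b\<in>B. \<exists>c. f b = c *\<^sub>R b)"
  using assms(3,4)
proof (induction "dim S" arbitrary: S rule: less_induct)
  case less
  show ?case
  proof (cases "S = {0}")
    case True
    then show ?thesis by (intro exI[of _ "{}"]) auto
  next
    case False
    obtain v c where v: "v \<in> S" "norm v = 1" "f v = c *\<^sub>R v"
      using selfadjoint_eigenvector[OF f sym less.prems False] by blast
    have vv: "v \<bullet> v = 1" using v by (simp add: norm_eq_1)
    define T where "T = S \<inter> {x. v \<bullet> x = 0}"
    have T: "subspace T"
      unfolding T_def using less.prems by (intro subspace_inter subspace_hyperplane)
    have "v \<notin> T" using vv by (simp add: T_def)
    moreover have "T \<subseteq> S" by (simp add: T_def)
    ultimately have "T \<subset> S" using v(1) by blast
    then have dim: "dim T < dim S"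
      using T less.prems(1) by (metis dim_psubset span_eq_iff)
    have "f ` T \<subseteq> T"
      using less.prems(2) v(3) by (auto simp: T_def simp flip: sym)
    from less.hyps[OF dim T this] obtain B where B:
      "pairwise orthogonal B" "\<forall>b\<in>B. norm b = 1" "span B = T"
      "\<forall>b\<in>B. \<exists>c. f b = c *\<^sub>R b" by blast
    have BT: "B \<subseteq> T" using B(3) span_superset by blast
    have "span (insert v B) = S"
    proof
      show "span (insert v B) \<subseteq> S"
        using v BT \<open>T \<subset> S\<close> less.prems(1) by (intro span_minimal) auto
      show "S \<subseteq> span (insert v B)"
      proof
        fix x assume "x \<in> S"
        then have "x - (v \<bullet> x) *\<^sub>R v \<in> span B"
          unfolding B(3) using v vv less.prems(1)
          by (auto simp: T_def inner_simps intro!: subspace_diff subspace_scale)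
        then show "x \<in> span (insert v B)" by (auto simp: span_insert)
      qed
    qed
    moreover have "pairwise orthogonal (insert v B)"
      using B(1) BT by (auto simp: pairwise_insert orthogonal_def T_def inner_commute)
    ultimately show ?thesis
      using B v by (intro exI[of _ "insert v B"]) auto
  qed
qed

lemma mat_mult_vec: "mat c *v v = c *\<^sub>R (v :: real ^ 'n)"
  by (simp add: matrix_vector_mult_def mat_def vec_eq_iff if_distrib[of "\<lambda>x. x * _"] cong: if_cong)

text \<open>This existence gives the choice in \<open>eigenvalues\<close> its meaning. Conjugation
  by the orthogonal matrix of eigenvectors turns \<open>mat t - A\<close> into a diagonal matrix
  without changing its determinant.\<close>

lemma symmetric_is_eigenvalue_vector:
  fixes A :: "real ^ 'n ^ 'n"
  assumes "transpose A = A"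
  shows "\<exists>l. is_eigenvalue_vector A l"
proof -
  have sym: "(A *v x) \<bullet> y = x \<bullet> (A *v y)" for x y
    by (metis assms dot_lmul_matrix vector_transpose_matrix)
  obtain B where B: "pairwise orthogonal B" "\<forall>b\<in>B. norm b = 1" "span B = (UNIV :: (real ^ 'n) set)"
      "\<forall>b\<in>B. \<exists>c. A *v b = c *\<^sub>R b"
    using selfadjoint_orthonormal_eigenbasis[of "(*v) A" UNIV] sym by auto
  have "0 \<notin> B" using B(2) by auto
  then have ind: "independent B" using B(1) by (simp add: pairwise_orthogonal_independent)
  then have "finite B" by (rule independent_imp_finite)
  have "card B = dim (span B)"
    using dim_eq_card_independent[OF ind] by simp
  then have "card B = CARD('n)" by (simp add: B(3) dim_UNIV)
  with \<open>finite B\<close> obtain b where b: "bij_betw b (UNIV :: 'n set) B"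
    using finite_same_card_bij[of "UNIV :: 'n set" B] by auto
  then have bB: "b j \<in> B" for j by (auto simp: bij_betw_def)
  have orth: "b i \<bullet> b j = (if i = j then 1 else 0)" for i j
  proof (cases "i = j")
    case True
    then show ?thesis using B(2) bB by (auto simp: norm_eq_1)
  next
    case False
    then have "b i \<noteq> b j" using b by (metis bij_betw_def injD)
    then show ?thesis using False B(1) bB by (auto simp: pairwise_def orthogonal_def)
  qed
  have "\<forall>j. \<exists>c. A *v b j = c *\<^sub>R b j"
    using B(4) bB by blast
  from choice[OF this] obtain l where l: "\<And>j. A *v b j = l j *\<^sub>R b j"
    by blast
  \<comment> \<open>The columns of P are the orthonormal eigenvectors, so its transpose is its
    inverse.\<close>
  define P :: "real ^ 'n ^ 'n" where "P = (\<chi> i j. b j $ i)"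
  have PP: "transpose P ** P = mat 1"
    using orth by (simp add: vec_eq_iff matrix_matrix_mult_def transpose_def P_def mat_def inner_vec_def)
  then have det1: "det (transpose P) * det P = 1"
    by (metis det_mul det_I)
  have "det (mat t - A) = (\<Prod>i\<in>UNIV. t - (\<chi> i. l i) $ i)" for t
  proof -
    have comp: "(transpose P ** ((mat t - A) ** P)) $ i $ j = (if i = j then t - l i else 0)" for i j
    proof -
      have "(transpose P ** ((mat t - A) ** P)) $ i $ j = b i \<bullet> ((mat t - A) *v b j)"
        by (simp add: matrix_matrix_mult_def transpose_def P_def inner_vec_def matrix_vector_mult_def)
      also have "(mat t - A) *v b j = (t - l j) *\<^sub>R b j"
        using l[of j] by (simp add: matrix_vector_mult_diff_rdistrib mat_mult_vec scaleR_left_diff_distrib)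
      finally show ?thesis by (auto simp: orth)
    qed
    have "det (transpose P ** ((mat t - A) ** P)) = (\<Prod>i\<in>UNIV. t - l i)"
      by (subst det_diagonal) (auto simp: comp)
    moreover have "det (transpose P ** ((mat t - A) ** P)) = (det (transpose P) * det P) * det (mat t - A)"
      by (simp add: det_mul)
    ultimately show ?thesis by (simp add: det1 del: det_transpose)
  qed
  then show ?thesis unfolding is_eigenvalue_vector_def by blast
qed

text \<open>At \<open>t = l $ i\<close> one factor of the characteristic polynomial vanishes, so
  \<open>mat (l $ i) - A\<close> is singular and has a nonzero kernel vector.\<close>

lemma is_eigenvalue_vector_eigenvector:
  fixes A :: "real ^ 'n ^ 'n"
  assumes "is_eigenvalue_vector A l"
  obtains v where "v \<noteq> 0" "A *v v = l $ i *\<^sub>R v"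
proof -
  have "det (mat (l $ i) - A) = 0"
    using assms by (auto simp: is_eigenvalue_vector_def)
  then obtain v where v: "v \<noteq> 0" "(mat (l $ i) - A) *v v = 0"
    by (metis invertible_det_nz matrix_left_invertible_ker invertible_left_inverse)
  from v(2) have "A *v v = l $ i *\<^sub>R v"
    by (simp add: matrix_vector_mult_diff_rdistrib mat_mult_vec)
  with v(1) show ?thesis by (rule that)
qed

text \<open>The form is tested on an eigenvector. The factor s is later 1 or -1, so that one lemma
  bounds the eigenvalues from below or from above.\<close>

lemma eigenvalues_form_ge:
  fixes A :: "real ^ 'n ^ 'n"
  assumes "transpose A = A" and form: "\<And>v. a * (v \<bullet> v) \<le> s * (v \<bullet> (A *v v))"
  shows "a \<le> s * eigenvalues A $ i"
proof -
  have "is_eigenvalue_vector A (eigenvalues A)"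
    unfolding eigenvalues_def using symmetric_is_eigenvalue_vector[OF assms(1)] by (rule someI_ex)
  then obtain v where v: "v \<noteq> 0" "A *v v = eigenvalues A $ i *\<^sub>R v"
    by (rule is_eigenvalue_vector_eigenvector)
  have "a * (v \<bullet> v) \<le> (s * eigenvalues A $ i) * (v \<bullet> v)"
    using form[of v] v(2) by (simp add: algebra_simps)
  then show ?thesis using v(1) by simp
qed

section \<open>Second derivatives: symmetry of the Hessian and the condition at a minimum\<close>

lemma partial_line_derivative:
  assumes "u differentiable (at (x + t *\<^sub>R v))"
  shows "((\<lambda>t. u (x + t *\<^sub>R v)) has_real_derivative (\<Sum>i\<in>UNIV. v $ i * partial i u (x + t *\<^sub>R v))) (at t)"
proof -
  let ?z = "x + t *\<^sub>R v"
  let ?F = "frechet_derivative u (at ?z)"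
  have F: "(u has_derivative ?F) (at ?z)"
    using assms by (simp add: frechet_derivative_works)
  then interpret F: linear ?F by (rule has_derivative_linear)
  have "?F v = ?F (\<Sum>i\<in>UNIV. v $ i *\<^sub>R axis i 1)"
    using basis_expansion[of v] by (simp add: scalar_mult_eq_scaleR)
  also have "\<dots> = (\<Sum>i\<in>UNIV. v $ i * partial i u ?z)"
    by (simp add: F.sum F.scale partial_def)
  finally have Fv: "?F v = (\<Sum>i\<in>UNIV. v $ i * partial i u ?z)" .
  have "((\<lambda>t. x + t *\<^sub>R v) has_derivative (\<lambda>h. h *\<^sub>R v)) (at t)"
    by (auto intro!: derivative_eq_intros)
  from has_derivative_compose[OF this F] show ?thesis
    unfolding has_field_derivative_def by (simp add: F.scale Fv mult_commute_abs)
qed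

lemma partial_axis_derivative:
  assumes "u differentiable (at (x + t *\<^sub>R axis i 1))"
  shows "((\<lambda>t. u (x + t *\<^sub>R axis i 1)) has_real_derivative partial i u (x + t *\<^sub>R axis i 1)) (at t)"
  using partial_line_derivative[OF assms]
  by (simp add: axis_def if_distrib[of "\<lambda>x. x * _"] cong: if_cong)

text \<open>The second difference is unchanged when i and j are swapped, whereas the limit names one
  order of differentiation; this yields the symmetry of the Hessian. The mean value theorem along
  axis i reduces the difference to two values of \<open>partial i u\<close>, which are then
  linearized at x.\<close>

lemma second_difference_estimate:
  fixes u :: "real ^ 'n \<Rightarrow> real"
  assumes "open D" "x \<in> D" and u: "\<And>y. y \<in> D \<Longrightarrow> u differentiable (at y)"
    and p: "partial i u differentiable (at x)"
  shows "((\<lambda>h. (u (x + h *\<^sub>R axis i 1 + h *\<^sub>R axis j 1) - u (x + h *\<^sub>R axis i 1)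
      - u (x + h *\<^sub>R axis j 1) + u x) / h\<^sup>2) \<longlongrightarrow> partial j (partial i u) x) (at_right 0)"
proof (rule tendstoI)
  fix e :: real assume "e > 0"
  let ?ei = "axis i 1 :: real ^ 'n" and ?ej = "axis j 1 :: real ^ 'n"
  let ?F = "frechet_derivative (partial i u) (at x)"
  have F: "(partial i u has_derivative ?F) (at x)"
    using p by (simp add: frechet_derivative_works)
  then interpret F: linear ?F by (rule has_derivative_linear)
  \<comment> \<open>The linearization errors occur at distances at most 2h and h from x. With the
    factor e/4 they add up to 3eh/4, which is below eh.\<close>
  have "e / 4 > 0" using \<open>e > 0\<close> by simp
  then obtain d where d: "d > 0"
    "\<And>y. norm (y - x) < d \<Longrightarrow> \<bar>partial i u y - partial i u x - ?F (y - x)\<bar> \<le> e / 4 * norm (y - x)"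
    using F unfolding has_derivative_at_alt real_norm_def by metis
  obtain r where r: "r > 0" "ball x r \<subseteq> D"
    using \<open>open D\<close> \<open>x \<in> D\<close> open_contains_ball by blast
  show "\<forall>\<^sub>F h in at_right 0. dist ((u (x + h *\<^sub>R ?ei + h *\<^sub>R ?ej) - u (x + h *\<^sub>R ?ei)
      - u (x + h *\<^sub>R ?ej) + u x) / h\<^sup>2) (partial j (partial i u) x) < e"
    unfolding eventually_at_right_field
  proof (intro exI conjI allI impI)
    \<comment> \<open>All points used lie within 2h of x, so half of the smaller radius keeps them
      in D and in the range of the linearization.\<close>
    show "0 < min d r / 2" using d r by simp
    fix h :: real assume h: "0 < h" "h < min d r / 2"
    have small: "norm (s *\<^sub>R ?ei + h *\<^sub>R ?ej) \<le> 2 * h" "norm (s *\<^sub>R ?ei) \<le> h" if "0 \<le> s" "s \<le> h" for s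
    proof -
      have "norm (s *\<^sub>R ?ei + h *\<^sub>R ?ej) \<le> norm (s *\<^sub>R ?ei) + norm (h *\<^sub>R ?ej)"
        by (rule norm_triangle_ineq)
      also have "\<dots> \<le> 2 * h" using that h by simp
      finally show "norm (s *\<^sub>R ?ei + h *\<^sub>R ?ej) \<le> 2 * h" .
      show "norm (s *\<^sub>R ?ei) \<le> h" using that by simp
    qed
    have D: "x + h *\<^sub>R ?ej + s *\<^sub>R ?ei \<in> D" "x + s *\<^sub>R ?ei \<in> D" if "0 \<le> s" "s \<le> h" for s
    proof -
      have "norm (s *\<^sub>R ?ei + h *\<^sub>R ?ej) < r" "norm (s *\<^sub>R ?ei) < r"
        using small[OF that] h by auto
      then have "x + h *\<^sub>R ?ej + s *\<^sub>R ?ei \<in> ball x r" "x + s *\<^sub>R ?ei \<in> ball x r"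
        by (auto simp: dist_norm norm_minus_commute add_ac)
      then show "x + h *\<^sub>R ?ej + s *\<^sub>R ?ei \<in> D" "x + s *\<^sub>R ?ei \<in> D" using r by auto
    qed
    \<comment> \<open>The increment of g from 0 to h is the whole second difference.\<close>
    define g where "g s = u (x + h *\<^sub>R ?ej + s *\<^sub>R ?ei) - u (x + s *\<^sub>R ?ei)" for s
    have g: "(g has_real_derivative partial i u (x + h *\<^sub>R ?ej + s *\<^sub>R ?ei) - partial i u (x + s *\<^sub>R ?ei)) (at s)"
      if "0 \<le> s" "s \<le> h" for s
      unfolding g_def using D[OF that] by (intro DERIV_diff partial_axis_derivative u)
    have "\<exists>s>0. s < h \<and>
      g h - g 0 = (h - 0) * (partial i u (x + h *\<^sub>R ?ej + s *\<^sub>R ?ei) - partial i u (x + s *\<^sub>R ?ei))"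
      using h(1) g by (intro MVT2)
    then obtain s where s: "0 < s" "s < h"
      "g h - g 0 = h * (partial i u (x + h *\<^sub>R ?ej + s *\<^sub>R ?ei) - partial i u (x + s *\<^sub>R ?ei))"
      by auto
    let ?y1 = "x + h *\<^sub>R ?ej + s *\<^sub>R ?ei" and ?y2 = "x + s *\<^sub>R ?ei"
    have y: "?y1 - x = s *\<^sub>R ?ei + h *\<^sub>R ?ej" "?y2 - x = s *\<^sub>R ?ei" by simp_all
    have n: "norm (?y1 - x) \<le> 2 * h" "norm (?y2 - x) \<le> h"
      unfolding y using small[of s] s by auto
    have "\<bar>partial i u ?y1 - partial i u x - ?F (?y1 - x)\<bar> \<le> e / 4 * norm (?y1 - x)"
      using n h by (intro d) auto
    also have "\<dots> \<le> e / 4 * (2 * h)" using n \<open>e > 0\<close> by (intro mult_left_mono) auto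
    finally have 1: "\<bar>partial i u ?y1 - partial i u x - ?F (?y1 - x)\<bar> \<le> e / 4 * (2 * h)" .
    have "\<bar>partial i u ?y2 - partial i u x - ?F (?y2 - x)\<bar> \<le> e / 4 * norm (?y2 - x)"
      using n h by (intro d) auto
    also have "\<dots> \<le> e / 4 * h" using n \<open>e > 0\<close> by (intro mult_left_mono) auto
    finally have 2: "\<bar>partial i u ?y2 - partial i u x - ?F (?y2 - x)\<bar> \<le> e / 4 * h" .
    have 3: "?F (?y1 - x) - ?F (?y2 - x) = h * partial j (partial i u) x"
      unfolding y by (simp add: F.add F.scale partial_def)
    define L where "L = partial j (partial i u) x"
    define Q where "Q = partial i u ?y1 - partial i u ?y2"
    have "\<bar>Q - h * L\<bar> \<le> e / 4 * (2 * h) + e / 4 * h"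
      using 1 2 3 unfolding L_def Q_def by linarith
    also have "\<dots> < e * h" using h \<open>e > 0\<close> by (simp add: field_simps)
    finally have "\<bar>Q - h * L\<bar> < e * h" .
    moreover have "(u (x + h *\<^sub>R ?ei + h *\<^sub>R ?ej) - u (x + h *\<^sub>R ?ei) - u (x + h *\<^sub>R ?ej) + u x) / h\<^sup>2 - L
      = (Q - h * L) / h"
    proof -
      have "u (x + h *\<^sub>R ?ei + h *\<^sub>R ?ej) - u (x + h *\<^sub>R ?ei) - u (x + h *\<^sub>R ?ej) + u x = h * Q"
        using s(3) by (simp add: g_def Q_def add_ac)
      then show ?thesis using h by (simp add: field_simps power2_eq_square)
    qed
    ultimately show "dist ((u (x + h *\<^sub>R ?ei + h *\<^sub>R ?ej) - u (x + h *\<^sub>R ?ei)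
      - u (x + h *\<^sub>R ?ej) + u x) / h\<^sup>2) (partial j (partial i u) x) < e"
      using h by (simp add: dist_real_def L_def[symmetric] divide_less_eq)
  qed
qed

lemma C2_on_hessian_symmetric:
  fixes u :: "real ^ 'n \<Rightarrow> real"
  assumes u: "C2_on u D" and "open D" "x \<in> D"
  shows "transpose (hessian u x) = hessian u x"
proof -
  have lim: "((\<lambda>h. (u (x + h *\<^sub>R axis i 1 + h *\<^sub>R axis j 1) - u (x + h *\<^sub>R axis i 1)
      - u (x + h *\<^sub>R axis j 1) + u x) / h\<^sup>2) \<longlongrightarrow> partial j (partial i u) x) (at_right 0)" for i j
    using assms by (intro second_difference_estimate[of D]) (auto simp: C2_on_def)
  have "partial j (partial i u) x = partial i (partial j u) x" for i j
    using tendsto_unique[OF _ lim[of i j]] lim[of j i] by (simp add: algebra_simps)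
  then show ?thesis by (simp add: transpose_def hessian_def vec_eq_iff)
qed

text \<open>If c were negative, then g', which vanishes at 0, would be negative just to the right of
  0, and the mean value theorem would give values of g below the minimum.\<close>

lemma second_derivative_nonneg_at_local_min:
  fixes g :: "real \<Rightarrow> real"
  assumes "e > 0"
    and g: "\<And>t. \<bar>t\<bar> < e \<Longrightarrow> (g has_real_derivative g' t) (at t)"
    and g': "(g' has_real_derivative c) (at 0)"
    and min: "\<And>t. \<bar>t\<bar> < e \<Longrightarrow> g 0 \<le> g t"
  shows "0 \<le> c"
proof (rule ccontr)
  assume "\<not> 0 \<le> c"
  then obtain d where d: "d > 0" "\<And>h. 0 < h \<Longrightarrow> h < d \<Longrightarrow> g' (0 + h) < g' 0"
    using DERIV_neg_dec_right[OF g'] by auto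
  have g'0: "g' 0 = 0"
    using g[of 0] min \<open>e > 0\<close> by (intro DERIV_local_min[of g _ 0 e]) auto
  define h where "h = min d e / 2"
  have h: "0 < h" "h < d" "h < e" using d \<open>e > 0\<close> by (auto simp: h_def)
  have "\<exists>z. 0 < z \<and> z < h \<and> g h - g 0 = (h - 0) * g' z"
    using h by (intro MVT2 g) auto
  then obtain z where z: "0 < z" "z < h" "g h - g 0 = h * g' z" by auto
  have "h * g' z < 0" using h z d(2)[of z] g'0 by (simp add: mult_pos_neg)
  with z min[of h] h show False by simp
qed

text \<open>The function \<open>s * u y - a / 2 * (y \<bullet> y)\<close> is restricted to the line
  through x in direction v, where the one-dimensional second-order condition applies.\<close>

lemma hessian_form_ge_at_local_min:
  fixes u :: "real ^ 'n \<Rightarrow> real"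
  assumes u: "C2_on u D" and "open D" "x \<in> D"
    and min: "\<And>y. y \<in> D \<Longrightarrow> s * u x - a / 2 * (x \<bullet> x) \<le> s * u y - a / 2 * (y \<bullet> y)"
  shows "a * (v \<bullet> v) \<le> s * (v \<bullet> (hessian u x *v v))"
proof -
  let ?l = "\<lambda>t. x + t *\<^sub>R v"
  have "open (?l -` D)"
    using \<open>open D\<close> by (intro continuous_open_vimage) (auto intro!: continuous_intros)
  moreover have "0 \<in> ?l -` D" using \<open>x \<in> D\<close> by simp
  ultimately obtain e where e: "e > 0" "ball 0 e \<subseteq> ?l -` D"
    using open_contains_ball by blast
  then have D: "?l t \<in> D" if "\<bar>t\<bar> < e" for t using that by (auto simp: subset_iff)
  define g where "g t = s * u (?l t) - a / 2 * (?l t \<bullet> ?l t)" for t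
  define g' where "g' t = s * (\<Sum>i\<in>UNIV. v $ i * partial i u (?l t)) - a * (?l t \<bullet> v)" for t
  have dq: "((\<lambda>t. a / 2 * (?l t \<bullet> ?l t)) has_real_derivative a * (?l t \<bullet> v)) (at t)" for t
    unfolding has_field_derivative_def
    by (rule derivative_eq_intros refl | simp add: inner_commute algebra_simps fun_eq_iff)+
  have dl: "((\<lambda>t. a * (?l t \<bullet> v)) has_real_derivative a * (v \<bullet> v)) (at t)" for t
    unfolding has_field_derivative_def
    by (rule derivative_eq_intros refl | simp add: inner_commute algebra_simps fun_eq_iff)+
  have "(g has_real_derivative g' t) (at t)" if "\<bar>t\<bar> < e" for t
    unfolding g_def g'_def using D[OF that] u
    by (intro DERIV_diff DERIV_cmult partial_line_derivative dq) (auto simp: C2_on_def)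
  moreover have "(g' has_real_derivative
      s * (\<Sum>i\<in>UNIV. v $ i * (\<Sum>j\<in>UNIV. v $ j * partial j (partial i u) (?l 0))) - a * (v \<bullet> v)) (at 0)"
    unfolding g'_def using \<open>x \<in> D\<close> u
    by (intro DERIV_diff DERIV_cmult DERIV_sum partial_line_derivative dl) (auto simp: C2_on_def)
  moreover have "g 0 \<le> g t" if "\<bar>t\<bar> < e" for t
    using min[OF D[OF that]] by (simp add: g_def)
  ultimately have "0 \<le> s * (\<Sum>i\<in>UNIV. v $ i * (\<Sum>j\<in>UNIV. v $ j * partial j (partial i u) (?l 0))) - a * (v \<bullet> v)"
    by (rule second_derivative_nonneg_at_local_min[OF e(1)])
  \<comment> \<open>Differentiating twice along the line produces
    \<open>partial j (partial i u)\<close>, which is the entry j, i of \<open>hessian u x\<close>;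
    hence the transpose, removed afterwards by symmetry.\<close>
  also have "(\<Sum>i\<in>UNIV. v $ i * (\<Sum>j\<in>UNIV. v $ j * partial j (partial i u) (?l 0)))
      = v \<bullet> (transpose (hessian u x) *v v)"
    by (simp add: inner_vec_def matrix_vector_mult_def hessian_def transpose_def mult.commute)
  finally show ?thesis
    using C2_on_hessian_symmetric[OF u \<open>open D\<close> \<open>x \<in> D\<close>] by simp
qed

section \<open>Elementary symmetric polynomials and the cone\<close>

lemma elem_sym_ge_power:
  fixes l :: "real ^ 'n"
  assumes "0 \<le> a" "\<And>i. a \<le> l $ i" "k \<le> CARD('n)"
  shows "a ^ k \<le> elem_sym k l"
proof -
  \<comment> \<open>The bound on k guarantees at least one summand. It alone is at least
    \<open>a ^ k\<close>, and the others are nonnegative.\<close>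
  obtain I :: "'n set" where I: "card I = k"
    using obtain_subset_with_card_n[OF assms(3)] by metis
  have nonneg: "0 \<le> l $ i" for i using assms(1) assms(2)[of i] by linarith
  have "a ^ k = (\<Prod>i\<in>I. a)" using I by simp
  also have "\<dots> \<le> (\<Prod>i\<in>I. l $ i)" using assms by (intro prod_mono) auto
  also have "\<dots> \<le> elem_sym k l"
    unfolding elem_sym_def using I nonneg
    by (intro member_le_sum[of I _ "\<lambda>I. \<Prod>i\<in>I. l $ i"]) (auto intro: prod_nonneg)
  finally show ?thesis .
qed

lemma elem_sym_1: "elem_sym 1 l = (\<Sum>i\<in>UNIV. l $ i)"
proof -
  have "{I :: 'a set. card I = 1} = range (\<lambda>i. {i})"
    by (auto simp: card_1_singleton_iff)
  then show ?thesis by (simp add: elem_sym_def sum.reindex)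
qed

text \<open>For Hessian eigenvalues this is subharmonicity. The half-space of nonnegative trace is
  closed and contains the cone, hence also its closure.\<close>

lemma elem_sym_1_nonneg:
  assumes "l \<in> closure (sigma_cone k)" "k \<ge> 1"
  shows "0 \<le> (\<Sum>i\<in>UNIV. l $ i)"
proof -
  have "closed {l :: real ^ 'a. 0 \<le> (\<Sum>i\<in>UNIV. l $ i)}"
    by (intro closed_Collect_le continuous_intros)
  moreover have "sigma_cone k \<subseteq> {l :: real ^ 'a. 0 \<le> (\<Sum>i\<in>UNIV. l $ i)}"
    using \<open>k \<ge> 1\<close> by (auto simp: sigma_cone_def elem_sym_1[symmetric] intro: less_imp_le)
  ultimately show ?thesis using assms(1) closure_minimal by blast
qed

section \<open>Maximum principle and comparison with paraboloids\<close>

lemma interior_min_eigenvalues_ge: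
  fixes u :: "real ^ 'n \<Rightarrow> real"
  assumes u: "admissible k (ball 0 1) u" and bd: "\<And>x. x \<in> sphere 0 1 \<Longrightarrow> u x = 0"
    and x: "x \<in> cball 0 1" "s * u x - a / 2 * (x \<bullet> x) < - a / 2"
  obtains y where "y \<in> ball 0 1" "\<And>i. a \<le> s * eigenvalues (hessian u y) $ i"
proof -
  \<comment> \<open>On the unit sphere w is constantly -a/2, so the smaller value at the given point
    forces the minimum into the open ball. Comparison from below takes s = 1; the maximum principle
    takes s = -1.\<close>
  define w where "w x = s * u x - a / 2 * (x \<bullet> x)" for x
  have "continuous_on (cball 0 1) w"
    unfolding w_def using u by (intro continuous_intros) (auto simp: admissible_def)
  then obtain y where y: "y \<in> cball 0 1" "\<And>z. z \<in> cball 0 1 \<Longrightarrow> w y \<le> w z"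
    using continuous_attains_inf[of "cball 0 1" w] by (metis compact_cball x(1) empty_iff)
  have "w y < - a / 2" using x y(2)[of x] by (simp add: w_def)
  then have "y \<notin> sphere 0 1" using bd[of y] by (auto simp: w_def norm_eq_1)
  then have yb: "y \<in> ball 0 1" using y(1) by auto
  have C2: "C2_on u (ball 0 1)" using u by (simp add: admissible_def)
  have "a * (v \<bullet> v) \<le> s * (v \<bullet> (hessian u y *v v))" for v
    using y(2) by (intro hessian_form_ge_at_local_min[OF C2 _ yb]) (auto simp: w_def)
  then have "a \<le> s * eigenvalues (hessian u y) $ i" for i
    using C2_on_hessian_symmetric[OF C2 open_ball yb] by (intro eigenvalues_form_ge)
  with yb show ?thesis by (rule that)
qed

lemma admissible_nonpos:
  fixes u :: "real ^ 'n \<Rightarrow> real"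
  assumes u: "admissible k (ball 0 1) u" and "k \<ge> 1"
    and bd: "\<And>x. x \<in> sphere 0 1 \<Longrightarrow> u x = 0" and x: "x \<in> cball 0 1"
  shows "u x \<le> 0"
proof (rule ccontr)
  assume "\<not> u x \<le> 0"
  moreover from this have "0 \<le> u x / 2 * (x \<bullet> x)" by simp
  \<comment> \<open>The positive value \<open>u x\<close> itself serves as a. All eigenvalues at the
    resulting interior minimum are then negative, which contradicts the nonnegative trace.\<close>
  ultimately have "- 1 * u x - u x / 2 * (x \<bullet> x) < - u x / 2" by linarith
  then obtain y where y: "y \<in> ball 0 1" "\<And>i. u x \<le> - 1 * eigenvalues (hessian u y) $ i"
    using interior_min_eigenvalues_ge[OF u bd x, of "- 1" "u x"] by blast
  have "eigenvalues (hessian u y) $ i < 0" for i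
    using y(2)[of i] \<open>\<not> u x \<le> 0\<close> by linarith
  then have "(\<Sum>i\<in>UNIV. eigenvalues (hessian u y) $ i) < (\<Sum>i\<in>(UNIV :: 'n set). 0)"
    by (intro sum_strict_mono) auto
  moreover have "eigenvalues (hessian u y) \<in> closure (sigma_cone k)"
    using u y(1) by (simp add: admissible_def)
  ultimately show False using elem_sym_1_nonneg[OF _ \<open>k \<ge> 1\<close>] by fastforce
qed

lemma admissible_ge_paraboloid:
  fixes u :: "real ^ 'n \<Rightarrow> real"
  assumes u: "admissible k (ball 0 1) u" and "k \<le> CARD('n)" "a > 0"
    and bd: "\<And>x. x \<in> sphere 0 1 \<Longrightarrow> u x = 0"
    and op: "\<And>x. x \<in> ball 0 1 \<Longrightarrow> hessian_op k u x < a ^ k" and x: "x \<in> cball 0 1"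
  shows "a / 2 * (x \<bullet> x - 1) \<le> u x"
proof (rule ccontr)
  assume "\<not> a / 2 * (x \<bullet> x - 1) \<le> u x"
  then have "1 * u x - a / 2 * (x \<bullet> x) < - a / 2" by (simp add: algebra_simps)
  then obtain y where y: "y \<in> ball 0 1" "\<And>i. a \<le> 1 * eigenvalues (hessian u y) $ i"
    using interior_min_eigenvalues_ge[OF u bd x, of 1 a] by blast
  have "a ^ k \<le> hessian_op k u y"
    unfolding hessian_op_def using y(2) assms by (intro elem_sym_ge_power) auto
  with op[OF y(1)] show False by simp
qed

text \<open>The factor 1/2 comes from the depth a/2 of the paraboloid at the origin. The comparison
  needs a positive a and a strict bound on the operator, so it is applied to every a above
  \<open>m powr (g / k)\<close>, and a then decreases to that value. This also covers m = 0.\<close>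

lemma admissible_lower_bound:
  fixes u :: "real ^ 'n \<Rightarrow> real"
  assumes u: "admissible k (ball 0 1) u" and k: "k \<in> {1..CARD('n)}"
    and bd: "\<And>x. x \<in> sphere 0 1 \<Longrightarrow> u x = 0"
    and op: "\<And>x. x \<in> ball 0 1 \<Longrightarrow> hessian_op k u x \<le> m powr g"
    and x: "x \<in> cball 0 1"
  shows "- u x \<le> 1 / 2 * m powr (g / k)"
proof -
  have "- 2 * u x \<le> a" if a: "m powr (g / k) < a" for a
  proof -
    have "0 \<le> m powr (g / k)" by simp
    with a have "a > 0" by linarith
    have "m powr g = (m powr (g / k)) ^ k" using k by (simp add: powr_powr flip: powr_realpow')
    also have "\<dots> < a ^ k" using a k by (intro power_strict_mono) auto
    finally have lt: "m powr g < a ^ k" .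
    have "a / 2 * (x \<bullet> x - 1) \<le> u x"
      using k \<open>a > 0\<close> lt op by (intro admissible_ge_paraboloid[OF u _ _ bd _ x]) (auto intro: le_less_trans)
    moreover have "0 \<le> a * (x \<bullet> x)" using \<open>a > 0\<close> by simp
    ultimately show ?thesis by (simp add: algebra_simps)
  qed
  then have "- 2 * u x \<le> m powr (g / k)" by (rule dense_ge)
  then show ?thesis by simp
qed

section \<open>The cyclic inequalities between the maxima\<close>

lemma cyclic_contraction_zero:
  fixes m \<theta> :: "nat \<Rightarrow> real"
  assumes "n \<ge> 1" and cyc: "m (Suc n) = m 1"
    and nonneg: "\<And>i. i \<in> {1..n} \<Longrightarrow> 0 \<le> m i"
    and le: "\<And>i. i \<in> {1..n} \<Longrightarrow> m i \<le> 1 / 2 * m (Suc i) powr \<theta> i"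
    and \<theta>: "\<And>i. i \<in> {1..n} \<Longrightarrow> 0 < \<theta> i" and prod: "(\<Prod>i=1..n. \<theta> i) = 1"
    and i: "i \<in> {1..n}"
  shows "m i = 0"
proof (rule ccontr)
  assume "m i \<noteq> 0"
  then have "0 < m i" using nonneg[OF i] by simp
  have step: "0 < m (Suc j)" if "j \<in> {1..n}" "0 < m j" for j
  proof -
    have "0 \<le> m (Suc j)" using that(1) nonneg cyc \<open>n \<ge> 1\<close> by (cases "j = n") auto
    \<comment> \<open>Since \<open>0 powr \<theta> j\<close> is 0, a vanishing
      \<open>m (Suc j)\<close> would force \<open>m j\<close> to be at most 0.\<close>
    moreover have "m (Suc j) \<noteq> 0" using that(2) le[OF that(1)] by auto
    ultimately show ?thesis by simp
  qed
  have up: "0 < m q" if "p \<le> q" "1 \<le> p" "q \<le> Suc n" "0 < m p" for p q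
    using that by (induction q rule: dec_induct) (auto intro: step)
  \<comment> \<open>Positivity travels upwards from i to \<open>Suc n\<close>, wraps around to 1,
    and from there reaches every index.\<close>
  have "0 < m 1" using up[of i "Suc n"] i \<open>0 < m i\<close> cyc by simp
  then have pos: "0 < m j" if "j \<in> {1..Suc n}" for j using up[of 1 j] that by simp
  define p where "p j = (\<Prod>i=1..<j. \<theta> i)" for j
  have p_pos: "0 < p j" if "j \<le> Suc n" for j
    unfolding p_def using that \<theta> by (intro prod_pos) auto
  have p_Suc: "p (Suc j) = p j * \<theta> j" if "j \<in> {1..n}" for j
    using that by (simp add: p_def)
  have "p j * ln (m j) - p (Suc j) * ln (m (Suc j)) < 0" if j: "j \<in> {1..n}" for j
  proof -
    \<comment> \<open>The factor 1/2 is spent here to obtain strictness; with exponents of product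
      1, non-strict inequalities would give no contradiction.\<close>
    have "m j < m (Suc j) powr \<theta> j"
      using le[OF j] pos[of j] j by auto
    then have "ln (m j) < \<theta> j * ln (m (Suc j))"
      using pos[of j] pos[of "Suc j"] j by (metis ln_less_cancel_iff ln_powr order_less_trans atLeastAtMost_iff le_SucI)
    then have "p j * ln (m j) < p j * (\<theta> j * ln (m (Suc j)))"
      using p_pos[of j] j by (intro mult_strict_left_mono) auto
    then show ?thesis using p_Suc[OF j] by simp
  qed
  then have "(\<Sum>j=1..n. p j * ln (m j) - p (Suc j) * ln (m (Suc j))) < (\<Sum>j=1..n. 0)"
    using \<open>n \<ge> 1\<close> by (intro sum_strict_mono) auto
  moreover have "(\<Sum>j=1..n. p (Suc j) * ln (m (Suc j)) - p j * ln (m j))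
      = p (Suc n) * ln (m (Suc n)) - p 1 * ln (m 1)"
    using \<open>n \<ge> 1\<close> by (intro sum_Suc_diff) auto
  \<comment> \<open>Both end weights are 1, one as an empty product and the other by
    \<open>prod\<close>, so the telescoped sum is \<open>ln (m (Suc n)) - ln (m 1)\<close>, which is
    0.\<close>
  moreover have "p (Suc n) = 1" "p 1 = 1"
    using prod by (simp_all add: p_def atLeastLessThanSuc_atLeastAtMost)
  ultimately show False using cyc by (simp add: sum_subtractf)
qed

section \<open>Application of the cyclic inequalities to the system\<close>

theorem theorem1p4:
  fixes n :: nat and k :: "nat \<Rightarrow> nat" and \<gamma> :: "nat \<Rightarrow> real"
  assumes "n \<ge> 2" and "CARD('N::finite) \<ge> 2"
    and "\<And>i. i \<in> {1..n} \<Longrightarrow> k i \<in> {1..CARD('N)}"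
    and "\<And>i. i \<in> {1..n} \<Longrightarrow> \<gamma> i > 0"
    and "(\<Prod>i=1..n. \<gamma> i) = (\<Prod>i=1..n. real (k i))"
  shows "\<not> (\<exists>u :: nat \<Rightarrow> real ^ 'N \<Rightarrow> real.
    admissible_solution n k \<gamma> u \<and> radial n u \<and> nontrivial n u)"
proof
  assume "\<exists>u :: nat \<Rightarrow> real ^ 'N \<Rightarrow> real.
    admissible_solution n k \<gamma> u \<and> radial n u \<and> nontrivial n u"
  then obtain u :: "nat \<Rightarrow> real ^ 'N \<Rightarrow> real"
    where sol: "admissible_solution n k \<gamma> u" and nt: "nontrivial n u" by blast
  have adm: "admissible (k i) (ball 0 1) (u i)" and bd: "\<And>x. x \<in> sphere 0 1 \<Longrightarrow> u i x = 0"
    if "i \<in> {1..n}" for i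
    using sol that by (auto simp: admissible_solution_def hessian_system_def)
  \<comment> \<open>The extra index \<open>Suc n\<close> stands for the first unknown again, so that
    the n equations take one common form.\<close>
  define w where "w i = (if i = Suc n then u 1 else u i)" for i
  have w: "w i = u i" if "i \<in> {1..n}" for i using that by (auto simp: w_def)
  have eq: "hessian_op (k i) (u i) x = (- w (Suc i) x) powr \<gamma> i"
    if "i \<in> {1..n}" "x \<in> ball 0 1" for i x
    using sol that by (cases "i = n") (auto simp: admissible_solution_def hessian_system_def w_def)
  have w_cases: "\<exists>j\<in>{1..n}. w i = u j" if "i \<in> {1..Suc n}" for i
    using that \<open>n \<ge> 2\<close> by (cases "i = Suc n") (auto simp: w_def)
  have nonpos: "w i x \<le> 0" if i: "i \<in> {1..Suc n}" and x: "x \<in> cball 0 1" for i x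
  proof -
    obtain j where j: "j \<in> {1..n}" "w i = u j" using w_cases[OF i] by blast
    then show ?thesis using admissible_nonpos[OF adm[OF j(1)] _ bd[OF j(1)] x] assms(3)[OF j(1)] by simp
  qed
  have "\<exists>y\<in>cball 0 1. \<forall>x\<in>cball 0 1. - w i x \<le> - w i y" if i: "i \<in> {1..Suc n}" for i
  proof -
    obtain j where j: "j \<in> {1..n}" "w i = u j" using w_cases[OF i] by blast
    show ?thesis using adm[OF j(1)]
      unfolding j(2) by (intro continuous_attains_sup continuous_intros) (auto simp: admissible_def)
  qed
  then obtain y where y: "\<And>i. i \<in> {1..Suc n} \<Longrightarrow> y i \<in> cball 0 1"
    "\<And>i x. i \<in> {1..Suc n} \<Longrightarrow> x \<in> cball 0 1 \<Longrightarrow> - w i x \<le> - w i (y i)"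
    by metis
  \<comment> \<open>The points \<open>y 1\<close> and \<open>y (Suc n)\<close> are chosen separately
    and may differ. Using \<open>y 1\<close> for both indices makes \<open>m (Suc n) = m 1\<close>
    hold by definition.\<close>
  define m where "m i = (if i = Suc n then - w 1 (y 1) else - w i (y i))" for i
  have m_ub: "- w i x \<le> m i" if "i \<in> {1..Suc n}" "x \<in> cball 0 1" for i x
    using y(2)[OF that] y(2)[of 1 x] that \<open>n \<ge> 2\<close> by (auto simp: m_def w_def)
  have "m i = 0" if "i \<in> {1..n}" for i
  proof (rule cyclic_contraction_zero[OF _ _ _ _ _ _ that])
    show "n \<ge> 1" "m (Suc n) = m 1" using \<open>n \<ge> 2\<close> by (auto simp: m_def)
    show "0 \<le> m i" if "i \<in> {1..n}" for i
      using nonpos[of i "y i"] y(1)[of i] that by (auto simp: m_def)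
    show "0 < \<gamma> i / k i" if "i \<in> {1..n}" for i
      using assms(3,4)[OF that] by simp
    have "(\<Prod>i=1..n. real (k i)) > 0"
      using assms(3) by (intro prod_pos) fastforce
    then show "(\<Prod>i=1..n. \<gamma> i / k i) = 1"
      unfolding prod_dividef assms(5) by (intro divide_self) (rule less_imp_neq[symmetric])
    fix i assume i: "i \<in> {1..n}"
    \<comment> \<open>Nonpositivity of w makes the base of the power nonnegative, so monotonicity of
      \<open>powr\<close> in its base applies.\<close>
    have "hessian_op (k i) (u i) x \<le> m (Suc i) powr \<gamma> i" if x: "x \<in> ball 0 1" for x
      unfolding eq[OF i x] using i x nonpos[of "Suc i" x] m_ub[of "Suc i" x] assms(4)[OF i]
      by (intro powr_mono2) auto
    moreover have "m i = - u i (y i)" using i by (auto simp: m_def w_def)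
    ultimately show "m i \<le> 1 / 2 * m (Suc i) powr (\<gamma> i / k i)"
      using admissible_lower_bound[OF adm[OF i] assms(3)[OF i] bd[OF i], of "m (Suc i)" "\<gamma> i" "y i"] y(1)[of i] i
      by auto
  qed
  \<comment> \<open>A vanishing maximum of \<open>- u i\<close> gives nonnegativity, and the maximum
    principle gives the opposite inequality.\<close>
  then have "u i x = 0" if "i \<in> {1..n}" "x \<in> cball 0 1" for i x
    using m_ub[of i x] nonpos[of i x] w[OF that(1)] that by fastforce
  with nt show False by (auto simp: nontrivial_def)
qed

end
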